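(* Let $\Omega\subset\mathbb{C}$ be a bounded convex domain that contains $0$ and has $C^{1,1}$-smooth boundary. Let $R_O$, $R_I$, $R_C$ denote its outer radius, inner radius and curvature radius. If $$(R_O-R_C)\,\frac{\log R_I-\log R_C}{R_I-R_C}+\frac12\log R_C\le 0,$$ where the difference quotient $\frac{\log R_I-\log R_C}{R_I-R_C}$ is understood as $1/R_I$ when $R_I=R_C$, then $\Omega=f(\mathbb{D})$ for some conformal map $f$ on $\mathbb{D}$ such that $f(0)=0$ and $\sup_{z\in\mathbb{D}}|f'(z)|\le 1$.
   Context: $\mathbb{D}=\{z\in\mathbb{C}:|z|<1\}$ is the open unit disk. A domain is a nonempty connected open set. A conformal map on $\mathbb{D}$ is an injective holomorphic function on $\mathbb{D}$. For a bounded convex domain $\Omega\subset\mathbb{C}$ with $0\in\Omega$ and $C^{1,1}$-smooth boundary: the outer radius $R_O$ is the smallest radius of a disk centered at $0$ and containing $\Omega$; the inner radius $R_I$ is the largest radius of a disk centered at $0$ and contained in $\Omega$; the curvature radius $R_C$ is the minimal radius of curvature of $\partial\Omega$, that is, the largest radius $R$ such that $\Omega$ can be written as a union of open disks of radius $R$. *)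

theory Defs
  imports "HOL-Analysis.Analysis" "HOL-Complex_Analysis.Complex_Analysis"
begin

definition outer_radius :: "complex set \<Rightarrow> real" where
  "outer_radius \<Omega> = Inf {r. 0 < r \<and> \<Omega> \<subseteq> ball 0 r}"

definition inner_radius :: "complex set \<Rightarrow> real" where
  "inner_radius \<Omega> = Sup {r. 0 < r \<and> ball 0 r \<subseteq> \<Omega>}"

definition curvature_radius :: "complex set \<Rightarrow> real" where
  "curvature_radius \<Omega> = Sup {R. 0 < R \<and> (\<exists>C. \<Omega> = (\<Union>c\<in>C. ball c R))}"

definition C11_on :: "real set \<Rightarrow> (real \<Rightarrow> real) \<Rightarrow> bool" where
  "C11_on S g \<longleftrightarrow>
     (\<exists>g' L. (\<forall>x\<in>S. (g has_real_derivative g' x) (at x)) \<and> L-lipschitz_on S g')"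

text \<open>
  An open set has a boundary of class \<open>C\<^sup>1\<^sup>,\<^sup>1\<close> if near each boundary point \<open>p\<close>, in the
  orthonormal coordinates \<open>(s, t)\<close> with origin \<open>p\<close> and axes \<open>u\<close> and \<open>\<i> u\<close>, it is the
  strict epigraph of a \<open>C\<^sup>1\<^sup>,\<^sup>1\<close> function. As \<open>p\<close> is a boundary point of an open set,
  \<open>g 0 = 0\<close> is forced.
\<close>
definition C11_boundary :: "complex set \<Rightarrow> bool" where
  "C11_boundary \<Omega> \<longleftrightarrow>
     (\<forall>p\<in>frontier \<Omega>. \<exists>u a b g. norm u = 1 \<and> 0 < a \<and> 0 < b \<and> C11_on {-a<..<a} g \<and>
        (\<forall>s t. \<bar>s\<bar> < a \<longrightarrow> \<bar>t\<bar> < b \<longrightarrow> (p + u * Complex s t \<in> \<Omega> \<longleftrightarrow> g s < t)))"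

definition ln_diff_quot :: "real \<Rightarrow> real \<Rightarrow> real" where
  "ln_diff_quot x y = (if x = y then 1 / x else (ln x - ln y) / (x - y))"

definition conformal_map_on_disk :: "(complex \<Rightarrow> complex) \<Rightarrow> bool" where
  "conformal_map_on_disk f \<longleftrightarrow> f holomorphic_on ball 0 1 \<and> inj_on f (ball 0 1)"

end

theory Submission
  imports Defs
begin

text \<open>
  By the maximum principle it is enough to bound \<open>f'(z)\<close> for \<open>z\<close> close to the unit circle. Let
  \<open>x = f(z)\<close>, let \<open>d\<close> be its distance to the complement of \<open>\<Omega>\<close>, and let \<open>p\<close> be a nearest boundary
  point. Comparison with a supporting half-plane at \<open>p\<close> gives \<open>|f'(z)| (1 - |z|\<^sup>2) \<le> 2d\<close>.
  Conversely, let \<open>B(c, R\<^sub>C)\<close> be the disk in \<open>\<Omega>\<close> touching the boundary at \<open>p\<close>, so that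
  \<open>|c| \<le> R\<^sub>O - R\<^sub>C\<close> and \<open>|x - c| = R\<^sub>C - d\<close>. By convexity, the disk about \<open>t c\<close> whose radius
  interpolates linearly between \<open>R\<^sub>I\<close> and \<open>R\<^sub>C\<close> is contained in \<open>\<Omega>\<close>. Integrating the
  Schwarz--Pick bound for \<open>f\<^sup>-\<^sup>1\<close> along the segment from \<open>0\<close> to \<open>c\<close> and then along the radius from
  \<open>c\<close> to \<open>x\<close> yields \<open>artanh |z| \<le> |c| q + artanh ((R\<^sub>C - d) / R\<^sub>C)\<close>, where \<open>q\<close> is the logarithmic
  difference quotient. The hypothesis says \<open>exp (2 |c| q) \<le> 1 / R\<^sub>C\<close>, and the two estimates combine to
  \<open>|f'(z)| (1 + |z|)\<^sup>2 \<le> 4\<close>.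
\<close>

section \<open>The Schwarz-Pick inequality and its integrated form\<close>

text \<open>Schwarz's lemma at the origin applies to \<open>k\<close>: here \<open>N\<close> carries
  the unit disk into \<open>ball a r\<close> with \<open>0\<close> going to \<open>z\<close>, and
  \<open>M\<close> is the disk automorphism sending \<open>h z\<close> to \<open>0\<close>. The
  chain rule at \<open>0\<close> produces the factors \<open>r * (1 - (norm w)\<^sup>2)\<close> and
  \<open>1 / (1 - (norm b)\<^sup>2)\<close>.\<close>

lemma Schwarz_Pick_deriv:
  assumes hol: "h holomorphic_on ball a r" and im: "h ` ball a r \<subseteq> ball 0 1"
    and z: "z \<in> ball a r"
  shows "norm (deriv h z) * (r\<^sup>2 - (dist a z)\<^sup>2) \<le> r * (1 - (norm (h z))\<^sup>2)"
proof -
  define w b where "w = (z - a) / of_real r" and "b = h z"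
  define M where "M = Moebius_function 0 b"
  define N where "N = (\<lambda>x. a + of_real r * Moebius_function 0 (-w) x)"
  define k where "k = (\<lambda>x. M (h (N x)))"
  have r: "r > 0" using z by (metis ball_empty empty_iff not_le)
  have w: "norm w < 1" using z r by (simp add: w_def norm_divide dist_norm norm_minus_commute)
  have b: "norm b < 1" using im z unfolding b_def by (metis image_subset_iff mem_ball_0)
  have N: "N x \<in> ball a r" if "norm x < 1" for x
  proof -
    have "norm (Moebius_function 0 (-w) x) < 1" using w that by (intro Moebius_function_norm_lt_1) auto
    then show ?thesis using r by (simp add: N_def dist_norm norm_mult)
  qed
  have N0: "N 0 = z" using r by (simp add: N_def w_def Moebius_function_simple)
  have hz: "(h has_field_derivative deriv h z) (at z)"
    using hol z by (metis holomorphic_derivI open_ball)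
  have dN: "(N has_field_derivative of_real r * (1 - of_real ((norm w)\<^sup>2))) (at 0)"
    unfolding N_def Moebius_function_simple complex_norm_square
    by (auto intro!: derivative_eq_intros simp: power2_eq_square algebra_simps)
  have nb: "1 - cnj b * b \<noteq> 0"
  proof
    assume "1 - cnj b * b = 0"
    then have "norm b ^ 2 = 1" by (metis complex_norm_square mult.commute of_real_eq_1_iff right_minus_eq of_real_power)
    then show False using b abs_square_less_1[of "norm b"] by simp
  qed
  have dM: "(M has_field_derivative (1 / (1 - cnj b * b))) (at b)"
    unfolding M_def Moebius_function_simple using nb
    by (auto intro!: derivative_eq_intros simp: power2_eq_square divide_simps)
  have "((\<lambda>x. h (N x)) has_field_derivative deriv h z * (of_real r * (1 - of_real ((norm w)\<^sup>2)))) (at 0)"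
    using DERIV_chain2[of h "deriv h z" N 0] hz dN N0 by auto
  then have dk: "(k has_field_derivative 1 / (1 - cnj b * b) *
      (deriv h z * (of_real r * (1 - of_real ((norm w)\<^sup>2))))) (at 0)"
    unfolding k_def using DERIV_chain2[of M "1 / (1 - cnj b * b)" "\<lambda>x. h (N x)" 0] dM
    by (simp only: b_def N0)
  have "N holomorphic_on ball 0 1"
    unfolding N_def using w by (intro holomorphic_intros Moebius_function_holomorphic) auto
  then have "(M \<circ> (h \<circ> N)) holomorphic_on ball 0 1"
    using N im hol b unfolding M_def
    by (intro holomorphic_on_compose_gen[of _ _ _ "ball 0 1"]
        holomorphic_on_compose_gen[of _ _ _ "ball a r"] Moebius_function_holomorphic) auto
  then have "k holomorphic_on ball 0 1" by (simp add: k_def o_def)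
  moreover have "k 0 = 0" by (simp add: k_def N0 M_def b_def Moebius_function_eq_zero)
  moreover have "norm (k x) < 1" if "norm x < 1" for x
    unfolding k_def M_def using b im N[OF that]
    by (intro Moebius_function_norm_lt_1) (auto simp: image_subset_iff simp del: mem_ball)
  ultimately have "norm (deriv k 0) \<le> 1"
    by (rule Schwarz_Lemma(2)[where \<xi> = 0]) auto
  moreover have "norm (1 - cnj b * b) = 1 - (norm b)\<^sup>2"
  proof -
    have "1 - cnj b * b = of_real (1 - (norm b)\<^sup>2)"
      by (simp only: of_real_diff of_real_1 complex_norm_square mult.commute)
    also have "norm \<dots> = 1 - (norm b)\<^sup>2" 
      unfolding norm_of_real using b by (simp add: power_le_one)
    finally show ?thesis .
  qed
  moreover have "norm (1 - complex_of_real ((norm w)\<^sup>2)) = 1 - (norm w)\<^sup>2"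
    using w by (metis abs_of_nonneg diff_ge_0_iff_ge less_eq_real_def norm_ge_zero norm_of_real
        of_real_1 of_real_diff power_le_one)
  moreover have pb: "1 - (norm b)\<^sup>2 > 0" using b by (simp add: abs_square_less_1)
  ultimately have "norm (deriv h z) * (r * (1 - (norm w)\<^sup>2)) \<le> 1 - (norm b)\<^sup>2"
    using DERIV_imp_deriv[OF dk] r by (simp add: norm_mult norm_divide pos_divide_le_eq)
  then have "r * (norm (deriv h z) * (r * (1 - (norm w)\<^sup>2))) \<le> r * (1 - (norm b)\<^sup>2)"
    using r by simp
  moreover have "r * (r * (1 - (norm w)\<^sup>2)) = r\<^sup>2 - (dist a z)\<^sup>2"
    using r by (simp add: w_def norm_divide dist_norm norm_minus_commute power_divide field_simps power2_eq_square)
  ultimately show ?thesis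
    unfolding b_def by (metis mult.left_commute)
qed

lemma artanh_real_mono:
  assumes "-1 < (x::real)" "x \<le> y" "y < 1"
  shows "artanh x \<le> artanh y"
  unfolding artanh_def using assms
  by (intro divide_right_mono ln_mono frac_le divide_pos_pos) auto

text \<open>For the density 1/(1 - |w|^2), \<open>artanh (norm w)\<close> is the hyperbolic distance
  from the origin, and the last hypothesis bounds the hyperbolic speed of the path by
  \<open>A'\<close>. Working with an antiderivative \<open>A\<close> and monotonicity avoids
  integrals.\<close>

lemma artanh_norm_path_le:
  fixes w :: "real \<Rightarrow> 'a::real_inner"
  assumes "a \<le> b"
    and w: "\<And>t. a \<le> t \<Longrightarrow> t \<le> b \<Longrightarrow> (w has_vector_derivative w' t) (at t)"
    and A: "\<And>t. a \<le> t \<Longrightarrow> t \<le> b \<Longrightarrow> (A has_real_derivative A' t) (at t)"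
    and w1: "\<And>t. a \<le> t \<Longrightarrow> t \<le> b \<Longrightarrow> norm (w t) < 1"
    and le: "\<And>t. a \<le> t \<Longrightarrow> t \<le> b \<Longrightarrow> norm (w' t) \<le> (1 - (norm (w t))\<^sup>2) * A' t"
  shows "artanh (norm (w b)) \<le> artanh (norm (w a)) + (A b - A a)"
proof -
  \<comment> \<open>\<open>norm\<close> is not differentiable at \<open>0\<close>, so project onto the direction of the end point instead.\<close>
  define e where "e = sgn (w b)"
  define F where "F = (\<lambda>t. e \<bullet> w t)"
  have e: "norm e \<le> 1" by (simp add: e_def norm_sgn)
  have ew: "\<bar>e \<bullet> x\<bar> \<le> norm x" for x
    using Cauchy_Schwarz_ineq2[of e x] e mult_right_mono[OF e norm_ge_zero[of x]] by simp
  have F1: "\<bar>F t\<bar> < 1" if "a \<le> t" "t \<le> b" for t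
    using ew[of "w t"] w1[OF that] by (simp add: F_def)
  have "artanh (F b) - A b \<le> artanh (F a) - A a"
  proof (rule DERIV_nonpos_imp_nonincreasing[OF \<open>a \<le> b\<close>])
    fix t assume t: "a \<le> t" "t \<le> b"
    have "(F has_real_derivative e \<bullet> w' t) (at t)"
      unfolding F_def has_real_derivative_iff_has_vector_derivative
      by (rule bounded_linear.has_vector_derivative[OF bounded_linear_inner_right w[OF t]])
    then have "((\<lambda>t. artanh (F t)) has_real_derivative 1 / (1 - (F t)\<^sup>2) * (e \<bullet> w' t)) (at t)"
      by (intro DERIV_chain2[OF artanh_real_has_field_derivative] F1[OF t])
    then have D: "((\<lambda>t. artanh (F t) - A t) has_real_derivative
        1 / (1 - (F t)\<^sup>2) * (e \<bullet> w' t) - A' t) (at t)"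
      by (intro DERIV_diff A t)
    have p: "0 < 1 - (F t)\<^sup>2" using F1[OF t] by (simp add: abs_square_less_1)
    have q: "0 < 1 - (norm (w t))\<^sup>2" using w1[OF t] by (simp add: abs_square_less_1)
    \<comment> \<open>The sign of \<open>A'\<close> matters: \<open>1 - (norm (w t))\<^sup>2\<close>
      is about to be replaced by the larger factor \<open>1 - (F t)\<^sup>2\<close>.\<close>
    have "0 \<le> (1 - (norm (w t))\<^sup>2) * A' t" using le[OF t] norm_ge_zero order_trans by blast
    then have "0 \<le> A' t" using q by (simp add: zero_le_mult_iff)
    moreover have "(F t)\<^sup>2 \<le> (norm (w t))\<^sup>2"
      unfolding F_def using ew[of "w t"] by (metis abs_ge_zero power2_abs power_mono)
    ultimately have "e \<bullet> w' t \<le> (1 - (F t)\<^sup>2) * A' t"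
      using ew[of "w' t"] le[OF t] mult_right_mono[of "1 - (norm (w t))\<^sup>2" "1 - (F t)\<^sup>2" "A' t"]
      by linarith
    then have "1 / (1 - (F t)\<^sup>2) * (e \<bullet> w' t) - A' t \<le> 0"
      using p by (simp add: pos_divide_le_eq mult.commute)
    with D show "\<exists>y. ((\<lambda>t. artanh (F t) - A t) has_real_derivative y) (at t) \<and> y \<le> 0"
      by blast
  qed
  \<comment> \<open>The projection loses nothing at \<open>b\<close>, even if
    \<open>w b = 0\<close>. At \<open>a\<close> it can only decrease the norm, which is the harmless
    direction.\<close>
  moreover have "F b = norm (w b)"
    by (cases "w b = 0") (auto simp: F_def e_def sgn_div_norm dot_square_norm power2_eq_square)
  moreover have "artanh (F a) \<le> artanh (norm (w a))"
    using F1[of a] ew[of "w a"] w1[of a] \<open>a \<le> b\<close> by (intro artanh_real_mono) (auto simp: F_def)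
  ultimately show ?thesis by simp
qed

section \<open>Supporting half-spaces and touching balls\<close>

text \<open>Separation gives only a weak inequality. Since \<open>S\<close> is open, every point can
  be moved slightly in direction \<open>v\<close> without leaving \<open>S\<close>, which makes it
  strict.\<close>

lemma supporting_halfspace:
  fixes S :: "'a::euclidean_space set"
  assumes "open S" "convex S" "S \<noteq> {}" "p \<notin> S"
  obtains u where "norm u = 1" "\<And>x. x \<in> S \<Longrightarrow> 0 < u \<bullet> (p - x)"
proof -
  obtain v \<beta> where v: "v \<noteq> 0" "\<forall>x\<in>S. v \<bullet> x \<le> \<beta>" "\<forall>x\<in>{p}. \<beta> \<le> v \<bullet> x"
    using separating_hyperplane_sets[of S "{p}"] assms by auto
  have "0 < sgn v \<bullet> (p - x)" if x: "x \<in> S" for x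
  proof -
    obtain e where e: "e > 0" "ball x e \<subseteq> S" using \<open>open S\<close> x openE by blast
    have "x + (e/2) *\<^sub>R sgn v \<in> ball x e" using e v by (simp add: dist_norm norm_sgn)
    then have "v \<bullet> (x + (e/2) *\<^sub>R sgn v) \<le> v \<bullet> p" using e v by fastforce
    moreover have "v \<bullet> sgn v > 0" using v by (simp add: sgn_div_norm)
    moreover have "0 < e / 2 * (v \<bullet> sgn v)" using e calculation by simp
    ultimately have "v \<bullet> x < v \<bullet> p" by (simp add: inner_add_right)
    then show ?thesis using v by (simp add: sgn_div_norm inner_diff_right)
  qed
  then show ?thesis using that[of "sgn v"] v by (simp add: norm_sgn)
qed

text \<open>The extreme point \<open>c + r *\<^sub>R u\<close> of the closed ball stays in the
  half-space, so \<open>u \<bullet> (p - c)\<close> is at least \<open>r\<close>. With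
  \<open>dist p c \<le> r\<close> this is the equality case of Cauchy-Schwarz. Hence all balls in
  \<open>S\<close> touching at \<open>p\<close> have their centres on one normal.\<close>

lemma touching_ball_center:
  fixes S :: "'a::euclidean_space set"
  assumes u: "norm u = 1" "\<And>x. x \<in> S \<Longrightarrow> 0 < u \<bullet> (p - x)"
    and ball: "ball c r \<subseteq> S" and r: "0 < r" "dist p c \<le> r"
  shows "c = p - r *\<^sub>R u"
proof -
  have "cball c r \<subseteq> {x. 0 \<le> u \<bullet> (p - x)}"
    unfolding closure_ball[OF r(1), symmetric]
  proof (rule closure_minimal)
    show "ball c r \<subseteq> {x. 0 \<le> u \<bullet> (p - x)}" using ball u by fastforce
    show "closed {x. 0 \<le> u \<bullet> (p - x)}" by (intro closed_Collect_le continuous_intros)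
  qed
  moreover have "c + r *\<^sub>R u \<in> cball c r" using u r by (simp add: dist_norm)
  ultimately have "0 \<le> u \<bullet> (p - (c + r *\<^sub>R u))" by blast
  then have 1: "r \<le> u \<bullet> (p - c)"
    using u by (simp add: algebra_simps inner_diff_right inner_add_right dot_square_norm)
  have "(norm ((p - c) - r *\<^sub>R u))\<^sup>2 = (norm (p - c))\<^sup>2 - 2 * r * (u \<bullet> (p - c)) + r\<^sup>2"
  proof -
    have "u \<bullet> u = 1" using u by (simp add: dot_square_norm)
    then show ?thesis
      unfolding power2_norm_eq_inner inner_diff_left[of "p - c"] inner_diff_right[of _ "p - c"]
      by (simp add: inner_commute[of "p - c" u] power2_eq_square)
  qed
  moreover have "(norm (p - c))\<^sup>2 \<le> r\<^sup>2" using r by (simp add: dist_norm power_mono)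
  moreover have "r * r \<le> r * (u \<bullet> (p - c))" using 1 r by simp
  ultimately have "(norm ((p - c) - r *\<^sub>R u))\<^sup>2 \<le> 0" by (simp add: power2_eq_square)
  then show ?thesis by (simp add: algebra_simps)
qed

text \<open>The ball about \<open>x\<close> with radius \<open>infdist x (-S)\<close> lies in
  \<open>S\<close> and touches the complement at \<open>p\<close>, so
  \<open>touching_ball_center\<close> places \<open>x\<close> on the inner normal at
  \<open>p\<close>.\<close>

lemma nearest_complement_point:
  fixes S :: "'a::euclidean_space set"
  assumes "open S" "convex S" "S \<noteq> UNIV" "x \<in> S"
  obtains p u where "p \<in> frontier S" "norm u = 1" "\<And>y. y \<in> S \<Longrightarrow> 0 < u \<bullet> (p - y)"
    "0 < infdist x (-S)" "x = p - infdist x (-S) *\<^sub>R u"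
proof -
  define d where "d = infdist x (-S)"
  have ne: "-S \<noteq> {}" and cl: "closed (-S)" using assms by auto
  obtain p where p: "p \<in> -S" "d = dist x p" unfolding d_def using infdist_attains_inf[OF cl ne] by blast
  have d: "d > 0" using p assms by auto
  have ball: "ball x d \<subseteq> S"
  proof
    fix y assume "y \<in> ball x d"
    then show "y \<in> S" using infdist_le[of y "-S" x] by (force simp: d_def)
  qed
  have "p \<in> closure (ball x d)" using d p by simp
  then have "p \<in> frontier S"
    using ball p closure_mono[OF ball] \<open>open S\<close> by (auto simp: frontier_def interior_open)
  moreover obtain u where u: "norm u = 1" "\<And>y. y \<in> S \<Longrightarrow> 0 < u \<bullet> (p - y)"
    using supporting_halfspace[OF assms(1,2), of p] p assms(4) by auto
  moreover have "x = p - d *\<^sub>R u"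
    using touching_ball_center[OF u ball d] p by (simp add: dist_commute)
  ultimately show ?thesis using that[of p u] d unfolding d_def by blast
qed

section \<open>Interior touching balls and the curvature radius\<close>

text \<open>This is the pointwise form of the curvature bound: it supplies a disk touching at a
  prescribed boundary point, whereas the covering in \<open>curvature_radius\<close> names no
  boundary point.\<close>

definition interior_ball_condition :: "'a::metric_space set \<Rightarrow> real \<Rightarrow> bool" where
  "interior_ball_condition S r \<longleftrightarrow> (\<forall>p\<in>frontier S. \<exists>c. ball c r \<subseteq> S \<and> dist p c = r)"

text \<open>A point at depth at least \<open>r\<close> is itself the centre of a suitable ball. A
  shallower point lies on the same normal as the centre of the touching ball at its nearest boundary
  point, at distance \<open>r - infdist x (-S)\<close> from that centre.\<close>

lemma interior_ball_condition_imp_Union_balls: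
  fixes S :: "'a::euclidean_space set"
  assumes S: "open S" "convex S" "S \<noteq> UNIV" and r: "0 < r" and ib: "interior_ball_condition S r"
  shows "S = (\<Union>c\<in>{c. ball c r \<subseteq> S}. ball c r)"
proof (intro equalityI subsetI)
  fix x assume x: "x \<in> S"
  obtain p u where p: "p \<in> frontier S" "norm u = 1" "\<And>y. y \<in> S \<Longrightarrow> 0 < u \<bullet> (p - y)"
    "0 < infdist x (-S)" "x = p - infdist x (-S) *\<^sub>R u"
    using nearest_complement_point[OF S x] by metis
  show "x \<in> (\<Union>c\<in>{c. ball c r \<subseteq> S}. ball c r)"
  proof (cases "infdist x (-S) \<ge> r")
    case True
    have "ball x r \<subseteq> S"
    proof
      fix y assume "y \<in> ball x r"
      then show "y \<in> S" using infdist_le[of y "-S" x] True by force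
    qed
    then show ?thesis using r by (intro UN_I[of x]) auto
  next
    case False
    obtain c where c: "ball c r \<subseteq> S" "dist p c = r"
      using ib p(1) by (auto simp: interior_ball_condition_def)
    have "c = p - r *\<^sub>R u" using touching_ball_center[OF p(2,3) c(1) r] c(2) by simp
    then have "c - x = (infdist x (-S) - r) *\<^sub>R u"
      by (subst p(5)) (simp add: algebra_simps)
    then have "dist c x < r" using p(2,4) False by (simp add: dist_norm)
    then show ?thesis using c(1) by (intro UN_I[of c]) auto
  qed
qed auto

text \<open>This handles a supremum of covering radii. Points of \<open>S\<close> tending to
  \<open>p\<close> lie in covering balls whose centres subconverge by compactness. The limit ball is
  still inside the open set \<open>S\<close>; its centre is within \<open>r\<close> of
  \<open>p\<close> by passing to the limit, and not closer because \<open>p\<close> is outside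
  \<open>S\<close>.\<close>

lemma interior_ball_condition_limit:
  fixes S :: "'a::euclidean_space set"
  assumes S: "open S" "bounded S" and r: "0 < r" and lim: "R \<longlonglongrightarrow> r"
    and cover: "\<And>n x. x \<in> S \<Longrightarrow> \<exists>c. x \<in> ball c (R n) \<and> ball c (R n) \<subseteq> S"
  shows "interior_ball_condition S r"
  unfolding interior_ball_condition_def
proof
  fix p assume p: "p \<in> frontier S"
  then have "p \<in> closure S" "p \<notin> S"
    using S(1) by (auto simp: frontier_def interior_open)
  then obtain x where x: "\<And>n. x n \<in> S" "x \<longlonglongrightarrow> p" by (auto simp: closure_sequential)
  have "\<forall>n. \<exists>c. x n \<in> ball c (R n) \<and> ball c (R n) \<subseteq> S" using cover x(1) by blast
  then obtain c where c: "\<And>n. x n \<in> ball (c n) (R n)" "\<And>n. ball (c n) (R n) \<subseteq> S"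
    by metis
  have "c n \<in> closure S" for n
    using c[of n] closure_subset
    by (metis centre_in_ball dist_commute dist_not_less_zero dual_order.strict_trans1 mem_ball not_le subsetD)
  moreover have "compact (closure S)" using S by simp
  ultimately obtain l f where l: "strict_mono (f :: nat \<Rightarrow> nat)" "(c \<circ> f) \<longlonglongrightarrow> l"
    unfolding compact_def by metis
  have R: "(\<lambda>n. R (f n)) \<longlonglongrightarrow> r" and xf: "(\<lambda>n. x (f n)) \<longlonglongrightarrow> p"
    using LIMSEQ_subseq_LIMSEQ[OF lim l(1)] LIMSEQ_subseq_LIMSEQ[OF x(2) l(1)] by (auto simp: o_def)
  have cf: "(\<lambda>n. c (f n)) \<longlonglongrightarrow> l" using l(2) by (simp add: o_def)
  have sub: "ball l r \<subseteq> S"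
  proof
    fix y assume "y \<in> ball l r"
    then have "0 < r - dist l y" by simp
    moreover have "(\<lambda>n. R (f n) - dist (c (f n)) y) \<longlonglongrightarrow> r - dist l y"
      by (intro tendsto_intros R cf)
    ultimately have "eventually (\<lambda>n. 0 < R (f n) - dist (c (f n)) y) sequentially"
      by (metis order_tendstoD(1))
    then obtain n where "0 < R (f n) - dist (c (f n)) y" by (auto simp: eventually_sequentially)
    then show "y \<in> S" using c(2)[of "f n"] by auto
  qed
  moreover have "dist p l \<le> r"
  proof (rule LIMSEQ_le[OF tendsto_dist[OF xf cf] R])
    show "\<exists>N. \<forall>n\<ge>N. dist (x (f n)) (c (f n)) \<le> R (f n)"
      using c(1) by (metis dist_commute less_imp_le mem_ball)
  qed
  moreover have "dist p l \<ge> r" using sub \<open>p \<notin> S\<close> by (force simp: dist_commute)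
  ultimately show "\<exists>c. ball c r \<subseteq> S \<and> dist p c = r" by (intro exI[of _ l]) auto
qed

text \<open>A Lipschitz bound on \<open>g'\<close> keeps the graph below a parabola with its vertex
  condition at the boundary point \<open>q\<close>: same value, same slope, quadratic coefficient
  \<open>L\<close>. A small disk tangent from above stays over that parabola, and the admissible
  size is the same for all \<open>q\<close> near \<open>p\<close>.\<close>

lemma C11_boundary_local_interior_ball:
  assumes S: "open S" and p: "p \<in> frontier S" and C11: "C11_boundary S"
  obtains e R where "0 < e" "0 < R"
    "\<And>q r. q \<in> frontier S \<Longrightarrow> dist p q < e \<Longrightarrow> 0 < r \<Longrightarrow> r \<le> R \<Longrightarrow> \<exists>c. ball c r \<subseteq> S \<and> dist q c = r"
proof -
  obtain u a b g where u: "norm u = 1" and ab: "0 < a" "0 < b" and g: "C11_on {-a<..<a} g"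
    and S_iff: "\<And>s t. \<bar>s\<bar> < a \<Longrightarrow> \<bar>t\<bar> < b \<Longrightarrow> p + u * Complex s t \<in> S \<longleftrightarrow> g s < t"
    using C11 p unfolding C11_boundary_def by meson
  obtain g' L where g': "\<And>x. x \<in> {-a<..<a} \<Longrightarrow> (g has_real_derivative g' x) (at x)"
    and L: "L-lipschitz_on {-a<..<a} g'"
    using g unfolding C11_on_def by metis
  have L0: "L \<ge> 0" using L by (rule lipschitz_on_nonneg)
  have u0: "u \<noteq> 0" using u by auto
  define chart where "chart = (\<lambda>y. (y - p) / u)"
  have chart: "p + u * Complex (Re (chart y)) (Im (chart y)) = y" for y
    using u0 by (simp add: chart_def)
  have norm_chart: "norm (chart y - chart z) = dist y z" for y z
    using u by (simp add: chart_def dist_norm norm_divide flip: diff_divide_distrib)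
  have chart_p: "chart p = 0" by (simp add: chart_def)
  have in_S: "y \<in> S \<longleftrightarrow> g (Re (chart y)) < Im (chart y)"
    if "\<bar>Re (chart y)\<bar> < a" "\<bar>Im (chart y)\<bar> < b" for y
    using S_iff[OF that] by (simp only: chart)
  \<comment> \<open>A point of the disk is within \<open>2 * r \<le> e\<close> of \<open>q\<close>,
    and \<open>q\<close> is within \<open>e\<close> of \<open>p\<close>, so the disk remains in the
    coordinate box. Using \<open>L + 1\<close> avoids division by zero when
    \<open>L = 0\<close>.\<close>
  define e where "e = min a b / 2"
  define R where "R = min (e / 2) (1 / (2 * (L + 1)))"
  have "0 < e" "0 < R" using ab L0 by (auto simp: e_def R_def)
  moreover have "\<exists>c. ball c r \<subseteq> S \<and> dist q c = r"
    if q: "q \<in> frontier S" "dist p q < e" and r: "0 < r" "r \<le> R" for q r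
  proof -
    define s0 t0 where "s0 = Re (chart q)" and "t0 = Im (chart q)"
    have "norm (chart q) < e" using norm_chart[of q p] q(2) by (simp add: chart_p dist_commute)
    then have st: "\<bar>s0\<bar> < e" "\<bar>t0\<bar> < e"
      using abs_Re_le_cmod[of "chart q"] abs_Im_le_cmod[of "chart q"] by (auto simp: s0_def t0_def)
    have box: "\<bar>s0\<bar> < a" "\<bar>t0\<bar> < b" using st ab by (auto simp: e_def)
    \<comment> \<open>The point \<open>q\<close> lies on the graph of \<open>g\<close>: not above
      it, being outside \<open>S\<close>, and not below it, being a limit of points of
      \<open>S\<close>.\<close>
    have "q \<notin> S" "q \<in> closure S" using q(1) S by (auto simp: frontier_def interior_open)
    then have "t0 \<le> g s0" using in_S[of q] box by (simp add: s0_def t0_def)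
    moreover have "g s0 \<le> t0"
    proof -
      obtain x where x: "\<And>n. x n \<in> S" "x \<longlonglongrightarrow> q"
        using \<open>q \<in> closure S\<close> by (auto simp: closure_sequential)
      have "(\<lambda>n. chart (x n)) \<longlonglongrightarrow> chart q"
        unfolding chart_def by (intro tendsto_intros x u0)
      then have re: "(\<lambda>n. Re (chart (x n))) \<longlonglongrightarrow> s0" and im: "(\<lambda>n. Im (chart (x n))) \<longlonglongrightarrow> t0"
        unfolding s0_def t0_def by (auto intro: tendsto_intros)
      have "isCont g s0" using g'[of s0] box by (auto intro: DERIV_isCont simp: abs_less_iff)
      then have "(\<lambda>n. g (Re (chart (x n)))) \<longlonglongrightarrow> g s0" by (rule isCont_tendsto_compose[OF _ re])
      moreover have "eventually (\<lambda>n. \<bar>Re (chart (x n))\<bar> < a) sequentially"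
        by (rule order_tendstoD(2)[OF tendsto_rabs[OF re] box(1)])
      moreover have "eventually (\<lambda>n. \<bar>Im (chart (x n))\<bar> < b) sequentially"
        by (rule order_tendstoD(2)[OF tendsto_rabs[OF im] box(2)])
      ultimately show ?thesis
        using tendsto_le[OF _ im, of "\<lambda>n. g (Re (chart (x n)))" "g s0"] in_S x(1)
        by (smt (verit, best) eventually_elim2 trivial_limit_sequentially)
    qed
    ultimately have t0: "t0 = g s0" by simp
    define m k where "m = g' s0" and "k = sqrt (1 + m\<^sup>2)"
    have k: "k \<ge> 1" "k\<^sup>2 = 1 + m\<^sup>2" by (auto simp: k_def)
    \<comment> \<open>The mean value theorem gives the coefficient \<open>L\<close> where Taylor's
      formula would give \<open>L / 2\<close>; the weaker constant suffices.\<close>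
    have upper: "g s \<le> t0 + m * (s - s0) + L * (s - s0)\<^sup>2" if s: "\<bar>s\<bar> < a" for s
    proof -
      have "\<exists>z. \<bar>z - s0\<bar> \<le> \<bar>s - s0\<bar> \<and> \<bar>z\<bar> < a \<and> g s - g s0 = (s - s0) * g' z"
      proof (cases s s0 rule: linorder_cases)
        case less
        then obtain z where "s < z" "z < s0" "g s0 - g s = (s0 - s) * g' z"
          using MVT2[OF less, of g g'] g' box s by (auto simp: abs_less_iff)
        then show ?thesis using box s by (intro exI[of _ z]) (auto simp: algebra_simps)
      next
        case equal
        then show ?thesis using box by (intro exI[of _ s0]) auto
      next
        case greater
        then obtain z where "s0 < z" "z < s" "g s - g s0 = (s - s0) * g' z"
          using MVT2[OF greater, of g g'] g' box s by (auto simp: abs_less_iff)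
        then show ?thesis using box s by (intro exI[of _ z]) auto
      qed
      then obtain z where z: "\<bar>z - s0\<bar> \<le> \<bar>s - s0\<bar>" "\<bar>z\<bar> < a" "g s - g s0 = (s - s0) * g' z" by blast
      have "\<bar>g' z - m\<bar> \<le> L * \<bar>z - s0\<bar>"
        using lipschitz_onD[OF L, of z s0] z box by (auto simp: dist_real_def m_def abs_less_iff)
      also have "\<dots> \<le> L * \<bar>s - s0\<bar>" using z L0 by (intro mult_left_mono) auto
      finally have "\<bar>s - s0\<bar> * \<bar>g' z - m\<bar> \<le> \<bar>s - s0\<bar> * (L * \<bar>s - s0\<bar>)"
        by (intro mult_left_mono) auto
      then have "(s - s0) * (g' z - m) \<le> L * (s - s0)\<^sup>2"
        by (simp add: power2_eq_square flip: abs_mult) (simp add: abs_mult algebra_simps)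
      then show ?thesis using z(3) t0 by (simp add: algebra_simps)
    qed
    \<comment> \<open>The upward unit normal to the graph at \<open>s0\<close>, where the slope is
      \<open>m\<close>.\<close>
    define n where "n = Complex (- m / k) (1 / k)"
    have "norm n = 1"
    proof -
      have "(norm n)\<^sup>2 = (1 + m\<^sup>2) / k\<^sup>2"
        by (simp add: n_def cmod_def power_divide add_divide_distrib)
      then have "(norm n)\<^sup>2 = 1" using k(1) unfolding k(2)[symmetric] by simp
      then show ?thesis using norm_ge_zero[of n] by (simp add: power2_eq_1_iff)
    qed
    define c where "c = q + u * (of_real r * n)"
    have "dist q c = r" using u r \<open>norm n = 1\<close> by (simp add: c_def dist_norm norm_mult)
    moreover have "ball c r \<subseteq> S"
    proof
      fix y assume y: "y \<in> ball c r"
      define X Y where "X = Re (chart y) - s0" and "Y = Im (chart y) - t0"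
      have "dist q y < 2 * r"
        using y \<open>dist q c = r\<close> dist_triangle[of q y c] by (simp add: dist_commute)
      then have "norm (chart y - chart q) < e" using norm_chart[of y q] r
        by (simp add: R_def dist_commute)
      then have "\<bar>X\<bar> < e" "\<bar>Y\<bar> < e"
        using abs_Re_le_cmod[of "chart y - chart q"] abs_Im_le_cmod[of "chart y - chart q"]
        by (auto simp: X_def Y_def s0_def t0_def)
      then have ybox: "\<bar>Re (chart y)\<bar> < a" "\<bar>Im (chart y)\<bar> < b"
        using st unfolding X_def Y_def e_def by linarith+
      have "chart c = chart q + of_real r * n"
        using u0 by (simp add: chart_def c_def field_simps)
      then have "chart y - chart c = Complex (X + r * m / k) (Y - r / k)"
        by (simp add: complex_eq_iff X_def Y_def s0_def t0_def n_def)
      then have "norm (Complex (X + r * m / k) (Y - r / k)) < r"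
        using norm_chart[of y c] y by (simp add: dist_commute)
      then have "(norm (Complex (X + r * m / k) (Y - r / k)))\<^sup>2 < r\<^sup>2"
        using r by (intro power_strict_mono) auto
      then have "(X + r * m / k)\<^sup>2 + (Y - r / k)\<^sup>2 < r\<^sup>2" by (simp add: cmod_def)
      moreover have "(X + r * m / k)\<^sup>2 + (Y - r / k)\<^sup>2 =
          X\<^sup>2 + Y\<^sup>2 - 2 * r * ((Y - m * X) / k) + r\<^sup>2 * ((1 + m\<^sup>2) / k\<^sup>2)"
        by (simp add: power2_eq_square field_simps add_divide_distrib diff_divide_distrib)
      moreover have "(1 + m\<^sup>2) / k\<^sup>2 = 1" using k(1) unfolding k(2)[symmetric] by simp
      \<comment> \<open>Here \<open>(Y - m * X) / k\<close> is the signed distance to the tangent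
        line. Since \<open>k \<ge> 1\<close> and \<open>2 * r \<le> 1 / (L + 1)\<close>, the
        inequality puts the point above the parabola from \<open>upper\<close>.\<close>
      ultimately have 1: "X\<^sup>2 + Y\<^sup>2 < 2 * r * ((Y - m * X) / k)" by simp
      then have "0 < 2 * r * ((Y - m * X) / k)" by (smt (verit) sum_power2_ge_zero)
      then have pos: "0 < Y - m * X" using r k by (simp add: zero_less_mult_iff zero_less_divide_iff)
      have "(Y - m * X) / k \<le> Y - m * X" using pos k by (simp add: pos_divide_le_eq)
      then have "2 * r * ((Y - m * X) / k) \<le> 2 * r * (Y - m * X)"
        using r by (intro mult_left_mono) auto
      also have "\<dots> \<le> 1 / (L + 1) * (Y - m * X)"
        using r pos L0 by (intro mult_right_mono) (auto simp: R_def field_simps)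
      finally have "X\<^sup>2 < 1 / (L + 1) * (Y - m * X)" using 1 zero_le_power2[of Y] by linarith
      then have "(L + 1) * X\<^sup>2 < Y - m * X" using L0 by (simp add: field_simps)
      then have "L * X\<^sup>2 < Y - m * X" using zero_le_power2[of X] unfolding distrib_right by linarith
      then have "g (Re (chart y)) < Im (chart y)"
        using upper[OF ybox(1)] by (simp add: X_def Y_def)
      then show "y \<in> S" using in_S ybox by blast
    qed
    ultimately show ?thesis by blast
  qed
  ultimately show ?thesis using that by blast
qed

text \<open>The local result covers every radius up to \<open>R\<close>, so on a finite subcover of
  the compact boundary the smallest of these bounds works everywhere.\<close>

lemma C11_boundary_interior_ball:
  assumes S: "open S" "bounded S" and C11: "C11_boundary S"
  obtains r where "0 < r" "interior_ball_condition S r"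
proof -
  have "\<exists>e R. p \<in> frontier S \<longrightarrow> 0 < e \<and> 0 < R \<and> (\<forall>q r. q \<in> frontier S \<longrightarrow> dist p q < e \<longrightarrow>
      0 < r \<longrightarrow> r \<le> R \<longrightarrow> (\<exists>c. ball c r \<subseteq> S \<and> dist q c = r))" for p
    using C11_boundary_local_interior_ball[OF S(1) _ C11, of p] by metis
  then obtain e R where eR: "\<And>p. p \<in> frontier S \<Longrightarrow> 0 < e p \<and> 0 < R p \<and>
      (\<forall>q r. q \<in> frontier S \<longrightarrow> dist p q < e p \<longrightarrow> 0 < r \<longrightarrow> r \<le> R p \<longrightarrow>
        (\<exists>c. ball c r \<subseteq> S \<and> dist q c = r))"
    by metis
  have "compact (frontier S)" using S by (simp add: compact_frontier_bounded)
  moreover have "frontier S \<subseteq> (\<Union>p\<in>frontier S. ball p (e p))" using eR by force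
  ultimately obtain F where F: "F \<subseteq> frontier S" "finite F" "frontier S \<subseteq> (\<Union>p\<in>F. ball p (e p))"
    using compactE_image[of "frontier S" "frontier S" "\<lambda>p. ball p (e p)"] by auto
  define r where "r = Min (insert 1 (R ` F))"
  have r: "0 < r" using F eR by (auto simp: r_def)
  moreover have "interior_ball_condition S r"
    unfolding interior_ball_condition_def
  proof
    fix q assume q: "q \<in> frontier S"
    then obtain p where p: "p \<in> F" "dist p q < e p" using F(3) by auto
    moreover have "r \<le> R p" using p F by (simp add: r_def)
    ultimately show "\<exists>c. ball c r \<subseteq> S \<and> dist q c = r" using eR q F(1) r by blast
  qed
  ultimately show ?thesis using that by blast
qed

text \<open>Smoothness of the boundary makes the set of covering radii nonempty and boundedness of
  \<open>S\<close> bounds it. Its supremum is therefore a limit of covering radii, to which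
  \<open>interior_ball_condition_limit\<close> applies.\<close>

lemma curvature_radius_interior_ball:
  assumes S: "open S" "bounded S" "convex S" "S \<noteq> {}" and C11: "C11_boundary S"
  shows "0 < curvature_radius S" "interior_ball_condition S (curvature_radius S)"
proof -
  define A where "A = {R. 0 < R \<and> (\<exists>C. S = (\<Union>c\<in>C. ball c R))}"
  have Sup: "curvature_radius S = Sup A" by (simp add: curvature_radius_def A_def)
  have nU: "S \<noteq> UNIV" using S(2) not_bounded_UNIV by auto
  obtain r where r: "0 < r" "interior_ball_condition S r"
    using C11_boundary_interior_ball[OF S(1,2) C11] .
  have rA: "r \<in> A"
    using r interior_ball_condition_imp_Union_balls[OF S(1,3) nU r] unfolding A_def by blast
  obtain B where B: "S \<subseteq> cball 0 B" using S(2) by (auto simp: bounded_iff subset_iff)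
  have "R \<le> B" if R: "R \<in> A" for R
  proof -
    obtain C where C: "0 < R" "S = (\<Union>c\<in>C. ball c R)" using R unfolding A_def by blast
    then obtain c where "c \<in> C" using S(4) by auto
    then have "ball c R \<subseteq> cball 0 B" using C B by blast
    then show ?thesis
      using C(1) by (simp add: ball_subset_cball_iff) (smt (verit) norm_ge_zero)
  qed
  then have bdd: "bdd_above A" by (auto simp: bdd_above_def)
  show pos: "0 < curvature_radius S" unfolding Sup using r(1) cSup_upper[OF rA bdd] by linarith
  have "Sup A \<in> closure A" using rA bdd by (intro closure_contains_Sup) auto
  then obtain R where R: "\<And>n. R n \<in> A" "R \<longlonglongrightarrow> Sup A" by (auto simp: closure_sequential)
  show "interior_ball_condition S (curvature_radius S)"
  proof (rule interior_ball_condition_limit[OF S(1,2) pos])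
    show "R \<longlonglongrightarrow> curvature_radius S" by (simp add: Sup R)
    show "\<exists>c. x \<in> ball c (R n) \<and> ball c (R n) \<subseteq> S" if "x \<in> S" for n x
    proof -
      obtain C where "S = (\<Union>c\<in>C. ball c (R n))" using R(1)[of n] unfolding A_def by blast
      then show ?thesis using that by blast
    qed
  qed
qed

section \<open>Derivative and distance estimates for the Riemann map and its inverse\<close>

text \<open>The map \<open>g\<close> takes values in the right half-plane, and a Cayley transform
  sends \<open>g z\<close> to \<open>0\<close> and the half-plane into the unit disk. Schwarz-Pick
  for the composite \<open>k\<close> at \<open>z\<close> gives the bound, because the derivative of
  the Cayley transform at \<open>A\<close> is \<open>1 / (2 * Re A)\<close>.\<close>

lemma halfplane_deriv_bound:
  assumes hol: "f holomorphic_on ball 0 1" and z: "norm z < 1"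
    and pos: "\<And>w. norm w < 1 \<Longrightarrow> 0 < u \<bullet> (p - f w)" and u: "norm u = 1"
  shows "norm (deriv f z) * (1 - (norm z)\<^sup>2) \<le> 2 * (u \<bullet> (p - f z))"
proof -
  define g where "g = (\<lambda>w. cnj u * (p - f w))"
  define A where "A = g z"
  define k where "k = (\<lambda>w. (g w - A) / (g w + cnj A))"
  have Re_g: "Re (g w) = u \<bullet> (p - f w)" for w by (simp add: g_def inner_complex_def)
  have Re_pos: "0 < Re (g w)" if "norm w < 1" for w using pos[OF that] by (simp add: Re_g)
  have A: "0 < Re A" using Re_pos[OF z] by (simp add: A_def)
  have nz: "g w + cnj A \<noteq> 0" if "norm w < 1" for w
    using Re_pos[OF that] A by (auto simp: complex_eq_iff)
  have "k holomorphic_on ball 0 1"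
    unfolding k_def g_def by (intro holomorphic_intros hol) (use nz in \<open>auto simp: g_def\<close>)
  moreover have "norm (k w) < 1" if w: "norm w < 1" for w
  proof -
    have "(norm (g w + cnj A))\<^sup>2 - (norm (g w - A))\<^sup>2 = 4 * (Re (g w) * Re A)"
      unfolding cmod_power2 by (simp add: power2_eq_square algebra_simps)
    moreover have "0 < Re (g w) * Re A" using Re_pos[OF w] A by simp
    ultimately have "norm (g w - A) < norm (g w + cnj A)"
      by (intro power2_less_imp_less[OF _ norm_ge_zero]) linarith
    then show ?thesis using nz[OF w] by (simp add: k_def norm_divide)
  qed
  ultimately have "norm (deriv k z) * (1\<^sup>2 - (dist 0 z)\<^sup>2) \<le> 1 * (1 - (norm (k z))\<^sup>2)"
    using z by (intro Schwarz_Pick_deriv) auto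
  then have sp: "norm (deriv k z) * (1 - (norm z)\<^sup>2) \<le> 1" by (simp add: k_def A_def)
  have "(f has_field_derivative deriv f z) (at z)"
    using hol z by (metis holomorphic_derivI open_ball mem_ball_0)
  then have dg: "(g has_field_derivative - (cnj u * deriv f z)) (at z)"
    unfolding g_def by (auto intro!: derivative_eq_intros)
  have "(k has_field_derivative (- (cnj u * deriv f z) * (g z + cnj A) - (g z - A) * (- (cnj u * deriv f z))) /
      ((g z + cnj A) * (g z + cnj A))) (at z)"
    unfolding k_def by (rule DERIV_divide) (use dg nz[OF z] in \<open>auto intro!: derivative_eq_intros\<close>)
  then have "deriv k z = - (cnj u * deriv f z) / (g z + cnj A)"
    using nz[OF z] by (auto dest!: DERIV_imp_deriv simp: A_def)
  moreover have "g z + cnj A = of_real (2 * Re A)" by (simp add: A_def complex_eq_iff)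
  ultimately have "norm (deriv k z) = norm (deriv f z) / (2 * Re A)"
    using u A by (simp add: norm_divide norm_mult)
  then have "norm (deriv f z) * (1 - (norm z)\<^sup>2) / (2 * Re A) \<le> 1" using sp by simp
  then show ?thesis using A by (simp add: pos_divide_le_eq A_def Re_g)
qed

text \<open>A point at offset \<open>y\<close> from the combined centre is the same convex
  combination of the points at offsets \<open>(r / \<rho>) *\<^sub>R y\<close> and
  \<open>(s / \<rho>) *\<^sub>R y\<close> from \<open>a\<close> and \<open>b\<close>, and these lie
  in the two balls.\<close>

lemma ball_convex_combination_subset:
  fixes S :: "'a::real_normed_vector set"
  assumes S: "convex S" and sub: "ball a r \<subseteq> S" "ball b s \<subseteq> S" and rs: "0 < r" "0 < s"
    and t: "0 \<le> t" "t \<le> 1"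
  shows "ball ((1 - t) *\<^sub>R a + t *\<^sub>R b) ((1 - t) * r + t * s) \<subseteq> S"
proof
  fix x assume x: "x \<in> ball ((1 - t) *\<^sub>R a + t *\<^sub>R b) ((1 - t) * r + t * s)"
  define \<rho> where "\<rho> = (1 - t) * r + t * s"
  define y where "y = x - ((1 - t) *\<^sub>R a + t *\<^sub>R b)"
  have y: "norm y < \<rho>" using x by (simp add: y_def \<rho>_def dist_norm norm_minus_commute)
  then have \<rho>: "0 < \<rho>" using norm_ge_zero[of y] by linarith
  have "q + (k / \<rho>) *\<^sub>R y \<in> ball q k" if "0 < k" for q k
  proof -
    have "k * norm y < k * \<rho>" using that y by simp
    then show ?thesis using that \<rho> by (simp add: dist_norm pos_divide_less_eq)
  qed
  then have "a + (r / \<rho>) *\<^sub>R y \<in> S" "b + (s / \<rho>) *\<^sub>R y \<in> S"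
    using sub rs by blast+
  then have "(1 - t) *\<^sub>R (a + (r / \<rho>) *\<^sub>R y) + t *\<^sub>R (b + (s / \<rho>) *\<^sub>R y) \<in> S"
    using t by (intro convexD[OF S]) auto
  also have "(1 - t) *\<^sub>R (a + (r / \<rho>) *\<^sub>R y) + t *\<^sub>R (b + (s / \<rho>) *\<^sub>R y) =
      (1 - t) *\<^sub>R a + t *\<^sub>R b + (((1 - t) * r + t * s) / \<rho>) *\<^sub>R y"
    by (simp add: algebra_simps add_divide_distrib diff_divide_distrib)
  also have "\<dots> = x" using \<rho> by (simp add: \<rho>_def[symmetric] y_def)
  finally show "x \<in> S" .
qed

lemma ln_diff_quot_pos:
  assumes "0 < x" "0 < y"
  shows "0 < ln_diff_quot x y"
  using assms ln_less_cancel_iff[of x y] ln_less_cancel_iff[of y x]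
  by (cases x y rule: linorder_cases) (auto simp: ln_diff_quot_def divide_neg_neg)

text \<open>Around the point \<open>of_real t * c\<close> the set contains a disk of radius
  \<open>\<rho> t\<close>. Schwarz-Pick at its centre bounds the hyperbolic speed of the image path
  by \<open>norm c / \<rho> t\<close>, whose integral over [0,1] is the logarithmic term.\<close>

lemma artanh_norm_along_segment:
  assumes S: "open S" "convex S" and sub: "ball 0 a \<subseteq> S" "ball c r \<subseteq> S" and ar: "0 < a" "0 < r"
    and h: "h holomorphic_on S" "h ` S \<subseteq> ball 0 1"
  shows "artanh (norm (h c)) \<le> artanh (norm (h 0)) + norm c * ln_diff_quot a r"
proof -
  define \<rho> where "\<rho> = (\<lambda>t. a + t * (r - a))"
  \<comment> \<open>An antiderivative of \<open>norm c / \<rho> t\<close>; it is linear when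
    \<open>a = r\<close>, where \<open>\<rho>\<close> is constant.\<close>
  define A where "A = (\<lambda>t. norm c * (if a = r then t / a else ln (\<rho> t) / (r - a)))"
  have \<rho>: "0 < \<rho> t" if "0 \<le> t" "t \<le> 1" for t
  proof -
    have "0 < (1 - t) * a + t * r"
      using that ar by (cases "t = 0") (auto intro!: add_nonneg_pos)
    then show ?thesis by (simp add: \<rho>_def algebra_simps)
  qed
  have ball: "ball (of_real t * c) (\<rho> t) \<subseteq> S" if "0 \<le> t" "t \<le> 1" for t
    using ball_convex_combination_subset[OF S(2) sub ar that]
    by (simp add: \<rho>_def algebra_simps scaleR_conv_of_real)
  have "artanh (norm (h (of_real 1 * c))) \<le> artanh (norm (h (of_real 0 * c))) + (A 1 - A 0)"
  proof (rule artanh_norm_path_le)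
    fix t :: real assume t: "0 \<le> t" "t \<le> 1"
    have inS: "of_real t * c \<in> S" using ball[OF t] \<rho>[OF t] by auto
    then have dh: "(h has_field_derivative deriv h (of_real t * c)) (at (of_real t * c))"
      using h(1) S(1) by (metis holomorphic_derivI)
    have "((\<lambda>t. of_real t * c) has_vector_derivative c) (at t)"
      by (auto intro!: derivative_eq_intros)
    from field_vector_diff_chain_at[OF this dh]
    show "((\<lambda>t. h (of_real t * c)) has_vector_derivative c * deriv h (of_real t * c)) (at t)"
      by (simp add: o_def)
    show "(A has_real_derivative norm c / \<rho> t) (at t)"
    proof (cases "a = r")
      case True
      then show ?thesis unfolding A_def \<rho>_def using ar
        by (auto intro!: derivative_eq_intros)
    next
      case False
      then show ?thesis unfolding A_def using \<rho>[OF t] unfolding \<rho>_def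
        by (auto intro!: derivative_eq_intros)
    qed
    show n1: "norm (h (of_real t * c)) < 1" using h(2) inS by (metis image_subset_iff mem_ball_0)
    have "norm (deriv h (of_real t * c)) * ((\<rho> t)\<^sup>2 - (dist (of_real t * c) (of_real t * c))\<^sup>2)
        \<le> \<rho> t * (1 - (norm (h (of_real t * c)))\<^sup>2)"
      using ball[OF t] \<rho>[OF t] h
      by (intro Schwarz_Pick_deriv) (auto intro: holomorphic_on_subset)
    then have "\<rho> t * (\<rho> t * norm (deriv h (of_real t * c))) \<le> \<rho> t * (1 - (norm (h (of_real t * c)))\<^sup>2)"
      by (simp add: power2_eq_square algebra_simps)
    then have "\<rho> t * norm (deriv h (of_real t * c)) \<le> 1 - (norm (h (of_real t * c)))\<^sup>2"
      using \<rho>[OF t] by simp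
    then have "norm (deriv h (of_real t * c)) \<le> (1 - (norm (h (of_real t * c)))\<^sup>2) / \<rho> t"
      using \<rho>[OF t] by (simp add: pos_le_divide_eq mult.commute)
    then have "norm c * norm (deriv h (of_real t * c)) \<le> norm c * ((1 - (norm (h (of_real t * c)))\<^sup>2) / \<rho> t)"
      by (intro mult_left_mono) auto
    then show "norm (c * deriv h (of_real t * c)) \<le> (1 - (norm (h (of_real t * c)))\<^sup>2) * (norm c / \<rho> t)"
      by (simp add: norm_mult mult_ac)
  qed simp
  moreover have "A 1 - A 0 = norm c * ln_diff_quot a r"
  proof (cases "a = r")
    case False
    have "A 1 - A 0 = norm c * ((ln r - ln a) / (r - a))"
      using False by (simp add: A_def \<rho>_def right_diff_distrib diff_divide_distrib)
    also have "(ln r - ln a) / (r - a) = (ln a - ln r) / (a - r)"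
      using False by (simp add: field_simps)
    finally show ?thesis using False by (simp add: ln_diff_quot_def)
  qed (simp add: A_def ln_diff_quot_def)
  ultimately show ?thesis by simp
qed

text \<open>Here one fixed disk is used, with Schwarz-Pick away from its centre: the speed bound at
  distance \<open>t\<close> is \<open>r / (r\<^sup>2 - t\<^sup>2)\<close>, the derivative of
  \<open>artanh (t / r)\<close>.\<close>

lemma artanh_norm_along_radius:
  assumes h: "h holomorphic_on ball c r" "h ` ball c r \<subseteq> ball 0 1" and x: "x \<in> ball c r"
  shows "artanh (norm (h x)) \<le> artanh (norm (h c)) + artanh (dist c x / r)"
proof -
  have r: "0 < r" using x by (metis ball_empty empty_iff not_le)
  \<comment> \<open>If \<open>x = c\<close> then \<open>e = 0\<close>. The estimates use only
    \<open>norm e \<le> 1\<close>, so this degenerate case is included.\<close>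
  define e where "e = sgn (x - c)"
  define l where "l = dist c x"
  have l: "0 \<le> l" "l < r" using x by (auto simp: l_def)
  have e: "norm e \<le> 1" by (simp add: e_def norm_sgn)
  have in_ball: "c + of_real t * e \<in> ball c r" if "0 \<le> t" "t \<le> l" for t
  proof -
    have "dist c (c + of_real t * e) = t * norm e" using that by (simp add: dist_norm norm_mult)
    also have "\<dots> \<le> t * 1" using that e by (intro mult_left_mono) auto
    finally show ?thesis using that l by simp
  qed
  have "artanh (norm (h (c + of_real l * e))) \<le> artanh (norm (h (c + of_real 0 * e))) + (artanh (l / r) - artanh (0 / r))"
  proof (rule artanh_norm_path_le[where A = "\<lambda>t. artanh (t / r)"])
    fix t :: real assume t: "0 \<le> t" "t \<le> l"
    have dh: "(h has_field_derivative deriv h (c + of_real t * e)) (at (c + of_real t * e))"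
      using h(1) in_ball[OF t] by (metis holomorphic_derivI open_ball)
    have "((\<lambda>t. c + of_real t * e) has_vector_derivative e) (at t)"
      by (auto intro!: derivative_eq_intros)
    from field_vector_diff_chain_at[OF this dh]
    show "((\<lambda>t. h (c + of_real t * e)) has_vector_derivative e * deriv h (c + of_real t * e)) (at t)"
      by (simp add: o_def)
    have tr: "\<bar>t / r\<bar> < 1" using t l r by simp
    show "((\<lambda>t. artanh (t / r)) has_real_derivative 1 / (1 - (t / r)\<^sup>2) * (1 / r)) (at t)"
      by (rule DERIV_chain2[where f = artanh and g = "\<lambda>t. t / r", OF artanh_real_has_field_derivative[OF tr, of UNIV]])
        (use r in \<open>auto intro!: derivative_eq_intros\<close>)
    show "norm (h (c + of_real t * e)) < 1" using h(2) in_ball[OF t] by (metis image_subset_iff mem_ball_0)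
    define D E where "D = norm (deriv h (c + of_real t * e))" and "E = 1 - (norm (h (c + of_real t * e)))\<^sup>2"
    have "D * (r\<^sup>2 - (dist c (c + of_real t * e))\<^sup>2) \<le> r * E"
      unfolding D_def E_def by (rule Schwarz_Pick_deriv[OF h in_ball[OF t]])
    moreover have "D * (r\<^sup>2 - t\<^sup>2) \<le> D * (r\<^sup>2 - (dist c (c + of_real t * e))\<^sup>2)"
    proof -
      have "dist c (c + of_real t * e) \<le> t"
        using t e mult_left_mono[OF e, of t] by (simp add: dist_norm norm_mult)
      then show ?thesis unfolding D_def by (intro mult_left_mono diff_left_mono power_mono) auto
    qed
    ultimately have *: "D * (r\<^sup>2 - t\<^sup>2) \<le> r * E" by linarith
    have p: "0 < r\<^sup>2 - t\<^sup>2" using t l by (simp add: power_strict_mono)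
    have "1 / (1 - (t / r)\<^sup>2) * (1 / r) = r / (r\<^sup>2 - t\<^sup>2)"
      using r p by (simp add: power_divide field_simps power2_eq_square)
    moreover have "D \<le> E * (r / (r\<^sup>2 - t\<^sup>2))" using * p by (simp add: pos_le_divide_eq mult.commute)
    moreover have "norm (e * deriv h (c + of_real t * e)) \<le> D"
      using mult_right_mono[OF e, of D] by (simp add: D_def norm_mult)
    ultimately show "norm (e * deriv h (c + of_real t * e))
        \<le> (1 - (norm (h (c + of_real t * e)))\<^sup>2) * (1 / (1 - (t / r)\<^sup>2) * (1 / r))"
      unfolding E_def by simp
  qed (use l in auto)
  moreover have "of_real l * e = x - c"
    by (cases "x = c") (auto simp: e_def l_def dist_norm norm_minus_commute sgn_eq)
  ultimately show ?thesis by (simp add: l_def)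
qed

section \<open>Inner and outer radii and the normalised Riemann map\<close>

lemma ball_inner_radius_subset:
  assumes "open S" "bounded S" "0 \<in> S"
  shows "0 < inner_radius S" "ball 0 (inner_radius S) \<subseteq> S"
proof -
  define A where "A = {r. 0 < r \<and> ball 0 r \<subseteq> S}"
  obtain r where r: "r \<in> A" using assms unfolding A_def by (metis (mono_tags) mem_Collect_eq openE)
  obtain B where B: "S \<subseteq> cball 0 B" using assms(2) by (auto simp: bounded_iff subset_iff)
  have "s \<le> B" if "s \<in> A" for s
  proof -
    have "0 < s" "ball 0 s \<subseteq> S" using that by (auto simp: A_def simp del: mem_ball)
    then have "0 < s" "ball (0::complex) s \<subseteq> cball 0 B" using B by (blast intro: order_trans)+
    then show ?thesis by (simp add: ball_subset_cball_iff)
  qed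
  then have bdd: "bdd_above A" by (auto simp: bdd_above_def)
  show "0 < inner_radius S"
    using cSup_upper[OF r bdd] r by (simp add: inner_radius_def A_def)
  show "ball 0 (inner_radius S) \<subseteq> S"
  proof
    fix x :: complex assume "x \<in> ball 0 (inner_radius S)"
    then have "norm x < Sup A" by (simp add: inner_radius_def A_def)
    then obtain s where "s \<in> A" "norm x < s" using less_cSup_iff[OF _ bdd] r by blast
    then show "x \<in> S" by (auto simp: A_def)
  qed
qed

lemma subset_cball_outer_radius:
  assumes "bounded S"
  shows "S \<subseteq> cball 0 (outer_radius S)"
proof
  fix x assume x: "x \<in> S"
  obtain B where "0 < B" "S \<subseteq> ball 0 B" using assms by (metis bounded_subset_ballD)
  then have "norm x \<le> Inf {r. 0 < r \<and> S \<subseteq> ball 0 r}"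
    using x by (intro cInf_greatest) (auto intro: less_imp_le)
  then show "x \<in> cball 0 (outer_radius S)" by (simp add: outer_radius_def)
qed

text \<open>A Riemann map need not send \<open>0\<close> to \<open>0\<close>; composing with a disk
  automorphism that moves \<open>h0 0\<close> to the origin corrects this. The holomorphic inverse
  \<open>h\<close> is kept because the distance estimates are applied to it.\<close>

lemma Riemann_map_fixing_0:
  assumes S: "open S" "simply_connected S" "0 \<in> S" "S \<noteq> UNIV"
  obtains f h where "f holomorphic_on ball 0 1" "f 0 = 0" "h holomorphic_on S"
    "\<And>x. x \<in> S \<Longrightarrow> norm (h x) < 1 \<and> f (h x) = x"
    "\<And>z. norm z < 1 \<Longrightarrow> f z \<in> S \<and> h (f z) = z"
proof -
  obtain h0 f0 where h0: "h0 holomorphic_on S" "f0 holomorphic_on ball 0 1"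
    "\<And>x. x \<in> S \<Longrightarrow> h0 x \<in> ball 0 1 \<and> f0 (h0 x) = x"
    "\<And>z. z \<in> ball 0 1 \<Longrightarrow> f0 z \<in> S \<and> h0 (f0 z) = z"
    using simply_connected_eq_biholomorphic_to_disc[OF S(1)] S(2-4) by (metis empty_iff)
  obtain m n where m: "m (h0 0) = 0" "m holomorphic_on ball 0 1" "m ` ball 0 1 \<subseteq> ball 0 1"
    "n holomorphic_on ball 0 1" "n ` ball 0 1 \<subseteq> ball 0 1"
    "\<And>z. z \<in> ball 0 1 \<Longrightarrow> m (n z) = z" "\<And>z. z \<in> ball 0 1 \<Longrightarrow> n (m z) = z"
    using ball_biholomorphism_exists[of "h0 0"] h0(3)[OF S(3)] by metis
  have mn: "m z \<in> ball 0 1" "n z \<in> ball 0 1" if "z \<in> ball 0 1" for z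
    using m(3,5) that by blast+
  show ?thesis
  proof
    show "(f0 \<circ> n) holomorphic_on ball 0 1"
      using holomorphic_on_compose_gen[OF m(4) h0(2) m(5)] .
    show "(m \<circ> h0) holomorphic_on S"
      using h0(3) by (intro holomorphic_on_compose_gen[OF h0(1) m(2)]) blast
    show "(f0 \<circ> n) 0 = 0" using m(1,7) h0(3)[OF S(3)] by (metis comp_apply)
    show "norm ((m \<circ> h0) x) < 1 \<and> (f0 \<circ> n) ((m \<circ> h0) x) = x" if "x \<in> S" for x
      using h0(3)[OF that] mn(1)[of "h0 x"] m(7)[of "h0 x"] by simp
    show "(f0 \<circ> n) z \<in> S \<and> (m \<circ> h0) ((f0 \<circ> n) z) = z" if "norm z < 1" for z
      using h0(4)[of "n z"] mn(2)[of z] m(6)[of z] that by simp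
  qed
qed

section \<open>Boundary estimate and conclusion by the maximum principle\<close>

text \<open>For each \<open>r\<close> below 1 with \<open>r > max \<rho> (norm z)\<close>, the
  maximum principle on \<open>cball 0 r\<close> bounds \<open>norm (F z)\<close> by
  \<open>B r\<close>, since the bound is constant on circles. Then \<open>r\<close> tends to
  1.\<close>

lemma norm_holomorphic_le_if_le_near_boundary:
  assumes hol: "F holomorphic_on ball 0 1" and "\<rho> < 1"
    and le: "\<And>z. \<rho> < norm z \<Longrightarrow> norm z < 1 \<Longrightarrow> norm (F z) \<le> B (norm z)"
    and lim: "(B \<longlongrightarrow> L) (at_left 1)" and z: "norm z < 1"
  shows "norm (F z) \<le> L"
proof (rule tendsto_lowerbound[OF lim])
  have "eventually (\<lambda>r. r \<in> {max \<rho> (norm z)<..<1}) (at_left (1::real))"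
    using \<open>\<rho> < 1\<close> z by (intro eventually_at_left_real) auto
  then show "eventually (\<lambda>r. norm (F z) \<le> B r) (at_left 1)"
  proof eventually_elim
    case (elim r)
    have r0: "r > 0" using elim by (auto intro: le_less_trans[OF norm_ge_zero[of z]])
    show ?case
    proof (rule maximum_modulus_frontier[of F "cball 0 r"])
      have sub: "cball 0 r \<subseteq> ball (0::complex) 1" using elim by auto
      show "F holomorphic_on interior (cball 0 r)"
        using hol sub by (meson holomorphic_on_subset interior_subset order_trans)
      show "continuous_on (closure (cball 0 r)) F"
        using continuous_on_subset[OF holomorphic_on_imp_continuous_on[OF hol] sub] by simp
      show "norm (F w) \<le> B r" if "w \<in> frontier (cball 0 r)" for w
        using le[of w] that elim r0 by auto
    qed (use elim in auto)
  qed
qed auto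

lemma conformal_map_deriv_bound_near_boundary:
  assumes S: "open S" "convex S" "S \<noteq> UNIV" and a: "0 < a" "ball 0 a \<subseteq> S"
    and R: "0 < R" "interior_ball_condition S R" and O: "S \<subseteq> cball 0 b"
    and cond: "(b - R) * ln_diff_quot a R + 1 / 2 * ln R \<le> 0"
    and f: "f holomorphic_on ball 0 1" "\<And>z. norm z < 1 \<Longrightarrow> f z \<in> S \<and> h (f z) = z"
    and h: "h holomorphic_on S" "h ` S \<subseteq> ball 0 1" "h 0 = 0"
    and z: "norm z < 1" and d: "infdist (f z) (-S) < R"
  shows "norm (deriv f z) \<le> 4 / (1 + norm z)\<^sup>2"
proof -
  define d where "d = infdist (f z) (-S)"
  define x where "x = f z"
  have x: "x \<in> S" "h x = z" using f(2)[OF z] by (auto simp: x_def)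
  obtain p u where p: "p \<in> frontier S" and u: "norm u = 1" "\<And>y. y \<in> S \<Longrightarrow> 0 < u \<bullet> (p - y)"
    and d0: "0 < d" and xp: "x = p - d *\<^sub>R u"
    using nearest_complement_point[OF S x(1)] unfolding d_def x_def by metis
  have dR: "d < R" using d by (simp add: d_def)
  have uu: "u \<bullet> u = 1" using u(1) by (simp add: dot_square_norm)
  have "norm (deriv f z) * (1 - (norm z)\<^sup>2) \<le> 2 * (u \<bullet> (p - x))"
    unfolding x_def using u f by (intro halfplane_deriv_bound z) auto
  then have upper: "norm (deriv f z) * (1 - (norm z)\<^sup>2) \<le> 2 * d" by (simp add: xp uu)
  obtain c where c: "ball c R \<subseteq> S" "dist p c = R"
    using R(2) p by (auto simp: interior_ball_condition_def)
  have "c = p - R *\<^sub>R u" using touching_ball_center[OF u c(1) R(1)] c(2) by simp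
  then have "c - x = (d - R) *\<^sub>R u" by (simp add: xp algebra_simps)
  \<comment> \<open>Both \<open>c\<close> and \<open>x\<close> lie on the normal at
    \<open>p\<close>, and \<open>d < R\<close> places \<open>x\<close> between \<open>c\<close> and
    \<open>p\<close>.\<close>
  then have cx: "dist c x = R - d" using u(1) dR by (simp add: dist_norm)
  have "ball c R \<subseteq> cball 0 b" using c(1) O by (rule order_trans)
  then have "norm c \<le> b - R" using R(1) by (simp add: ball_subset_cball_iff)
  then have "norm c * ln_diff_quot a R \<le> (b - R) * ln_diff_quot a R"
    using ln_diff_quot_pos[OF a(1) R(1)] by (intro mult_right_mono) auto
  then have 1: "norm c * ln_diff_quot a R \<le> - (ln R / 2)" using cond by linarith
  have "artanh (norm z) \<le> artanh (norm (h c)) + artanh (dist c x / R)"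
    using artanh_norm_along_radius[of h c R x] h c(1) cx d0 x(2)
    by (simp add: holomorphic_on_subset subset_trans[OF image_mono[OF c(1)] h(2)])
  moreover have "artanh (norm (h c)) \<le> norm c * ln_diff_quot a R"
    using artanh_norm_along_segment[OF S(1,2) a(2) c(1) a(1) R(1) h(1,2)] h(3) by simp
  ultimately have "artanh (norm z) \<le> artanh ((R - d) / R) - ln R / 2" using 1 cx by simp
  moreover have "(1 + (R - d) / R) / (1 - (R - d) / R) = (2 * R - d) / d"
    using R(1) d0 by (simp add: field_simps)
  ultimately have "ln ((1 + norm z) / (1 - norm z)) \<le> ln ((2 * R - d) / d) - ln R"
    by (simp add: artanh_def)
  also have "\<dots> = ln ((2 * R - d) / d / R)"
    using R(1) d0 dR by (subst ln_div[of "(2 * R - d) / d"]) auto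
  finally have "(1 + norm z) / (1 - norm z) \<le> (2 * R - d) / d / R"
    using R(1) d0 dR z norm_ge_zero[of z]
    by (subst (asm) ln_le_cancel_iff) (auto intro!: divide_pos_pos add_pos_nonneg)
  \<comment> \<open>Dropping \<open>- d\<close> from the numerator cancels \<open>R\<close> and
    leaves a bound inversely proportional to \<open>d\<close>, which matches \<open>upper\<close>,
    where \<open>d\<close> appears linearly.\<close>
  also have "\<dots> \<le> 2 / d" using R(1) d0 by (simp add: field_simps)
  finally have lower: "d * (1 + norm z) \<le> 2 * (1 - norm z)"
    using d0 z by (simp add: field_simps)
  \<comment> \<open>Multiplying \<open>upper\<close> by \<open>1 + norm z\<close> allows
    \<open>lower\<close> to eliminate \<open>d\<close>; the common positive factor
    \<open>1 - norm z\<close> then cancels.\<close>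
  have "(1 - norm z) * (norm (deriv f z) * (1 + norm z)\<^sup>2) =
      (norm (deriv f z) * (1 - (norm z)\<^sup>2)) * (1 + norm z)"
    by (simp add: power2_eq_square algebra_simps)
  also have "\<dots> \<le> 2 * d * (1 + norm z)" using upper by (intro mult_right_mono) auto
  also have "\<dots> \<le> (1 - norm z) * 4" using lower by simp
  finally have "norm (deriv f z) * (1 + norm z)\<^sup>2 \<le> 4" using z by (subst (asm) mult_le_cancel_left_pos) auto
  moreover have "0 < (1 + norm z)\<^sup>2" by (intro zero_less_power add_pos_nonneg) auto
  ultimately show ?thesis by (simp add: pos_le_divide_eq)
qed

lemma infdist_small_near_unit_circle:
  fixes S :: "'a::euclidean_space set"
  assumes S: "bounded S" and r: "0 < r" and h: "continuous_on S h"
    and im: "h ` S \<subseteq> ball (0::complex) 1"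
    and f: "\<And>z. norm z < 1 \<Longrightarrow> f z \<in> S \<and> h (f z) = z"
  obtains \<rho> where "\<rho> < 1" "\<And>z. \<rho> < norm z \<Longrightarrow> norm z < 1 \<Longrightarrow> infdist (f z) (-S) < r"
proof -
  define K where "K = {x. r \<le> infdist x (-S)}"
  have KS: "K \<subseteq> S" using r unfolding K_def by (metis (mono_tags) ComplI infdist_zero mem_Collect_eq not_le subsetI)
  have "closed K" unfolding K_def by (intro closed_Collect_le continuous_intros)
  then have "compact K" using KS S(1) bounded_subset compact_eq_bounded_closed by blast
  then have comp: "compact (h ` K)" using h KS continuous_on_subset by (intro compact_continuous_image) auto
  show ?thesis
  proof (cases "K = {}")
    case True
    then show ?thesis using that[of 0] by (auto simp: K_def not_le)
  next
    case False
    then obtain w where w: "w \<in> h ` K" "\<And>v. v \<in> h ` K \<Longrightarrow> dist 0 v \<le> dist 0 w"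
      using distance_attains_sup[OF comp, of 0] by blast
    show ?thesis
    proof
      show "norm w < 1" using w(1) KS im by force
      show "infdist (f z) (-S) < r" if "norm w < norm z" "norm z < 1" for z
      proof (rule ccontr)
        assume "\<not> infdist (f z) (-S) < r"
        then have "h (f z) \<in> h ` K" by (auto simp: K_def)
        then show False using w(2)[of "h (f z)"] f[OF that(2)] that(1) by simp
      qed
    qed
  qed
qed

theorem theorem1p1:
  fixes \<Omega> :: "complex set" and R\<^sub>O R\<^sub>I R\<^sub>C :: real
  assumes "open \<Omega>" and "connected \<Omega>" and "bounded \<Omega>" and "convex \<Omega>" and "0 \<in> \<Omega>"
    and "C11_boundary \<Omega>"
    and "R\<^sub>O = outer_radius \<Omega>" and "R\<^sub>I = inner_radius \<Omega>" and "R\<^sub>C = curvature_radius \<Omega>"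
    and "(R\<^sub>O - R\<^sub>C) * ln_diff_quot R\<^sub>I R\<^sub>C + 1 / 2 * ln R\<^sub>C \<le> 0"
  shows "\<exists>f. conformal_map_on_disk f \<and> f ` ball 0 1 = \<Omega> \<and> f 0 = 0 \<and>
             (SUP z\<in>ball 0 1. ereal (norm (deriv f z))) \<le> 1"
proof -
  have nU: "\<Omega> \<noteq> UNIV" using assms(3) not_bounded_UNIV by auto
  have inner: "0 < R\<^sub>I" "ball 0 R\<^sub>I \<subseteq> \<Omega>"
    unfolding assms(8) using ball_inner_radius_subset[OF assms(1,3,5)] by auto
  have outer: "\<Omega> \<subseteq> cball 0 R\<^sub>O" unfolding assms(7) by (rule subset_cball_outer_radius[OF assms(3)])
  have curv: "0 < R\<^sub>C" "interior_ball_condition \<Omega> R\<^sub>C"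
    unfolding assms(9) using curvature_radius_interior_ball[OF assms(1,3,4) _ assms(6)] assms(5) by auto
  obtain f h where f: "f holomorphic_on ball 0 1" "f 0 = 0" and h: "h holomorphic_on \<Omega>"
    and hf: "\<And>x. x \<in> \<Omega> \<Longrightarrow> norm (h x) < 1 \<and> f (h x) = x"
    and fh: "\<And>z. norm z < 1 \<Longrightarrow> f z \<in> \<Omega> \<and> h (f z) = z"
    using Riemann_map_fixing_0[OF assms(1) convex_imp_simply_connected[OF assms(4)] assms(5) nU] by metis
  have him: "h ` \<Omega> \<subseteq> ball 0 1" using hf by auto
  have h0: "h 0 = 0" using fh[of 0] f(2) by simp
  obtain \<rho> where \<rho>: "\<rho> < 1" "\<And>z. \<rho> < norm z \<Longrightarrow> norm z < 1 \<Longrightarrow> infdist (f z) (-\<Omega>) < R\<^sub>C"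
    using infdist_small_near_unit_circle[OF assms(3) curv(1) holomorphic_on_imp_continuous_on[OF h] him fh]
    by metis
  have "norm (deriv f z) \<le> 1" if "norm z < 1" for z
  proof (rule norm_holomorphic_le_if_le_near_boundary[OF _ \<rho>(1) _ _ that])
    show "deriv f holomorphic_on ball 0 1" using f(1) by (intro holomorphic_deriv) auto
    show "norm (deriv f w) \<le> 4 / (1 + norm w)\<^sup>2" if "\<rho> < norm w" "norm w < 1" for w
      by (rule conformal_map_deriv_bound_near_boundary[OF assms(1,4) nU inner curv outer assms(10) f(1) fh h him h0
            that(2) \<rho>(2)[OF that]])
    \<comment> \<open>The boundary estimate exceeds 1 inside the disk; only its limit at the unit
      circle gives the sharp constant.\<close>
    have "((\<lambda>r::real. 4 / (1 + r)\<^sup>2) \<longlongrightarrow> 4 / (1 + 1)\<^sup>2) (at_left 1)"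
      by (intro tendsto_intros) auto
    then show "((\<lambda>r::real. 4 / (1 + r)\<^sup>2) \<longlongrightarrow> 1) (at_left 1)" by simp
  qed
  then have "(SUP z\<in>ball 0 1. ereal (norm (deriv f z))) \<le> 1"
    by (intro SUP_least) simp
  moreover have "conformal_map_on_disk f"
    unfolding conformal_map_on_disk_def using f(1) fh by (auto intro: inj_on_inverseI[of _ h])
  moreover have "f ` ball 0 1 = \<Omega>"
    using hf fh by (force simp: image_iff)
  ultimately show ?thesis using f(2) by blast
qed

end
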